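(* Let $\omega=\exp\{i\pi/6\}$. For all $p_1,p_2\in[0,1)$, with $a=\exp\{2i\pi p_1\}$ and $b=\exp\{2i\pi p_2\}$, the $10\times 10$ matrix $Y(p_1,p_2)$ whose first row and first column consist of ones and whose remaining $9\times 9$ submatrix (obtained by deleting the first row and first column) is $$\begin{bmatrix} 1 & -i & i & i & -i & \omega^4 & \omega^4 & \omega^8 & \omega^8\\ 1 & i & -1 & -1 & i & \omega^{11} & \omega^{11} & \omega^7 & \omega^7\\ i & \omega^8 & \omega^{10} & \omega^7 & \omega^{11} & a & -a & \omega^4 & \omega^4\\ i & \omega^4 & \omega^2 & \omega^{11} & \omega^7 & \omega^8 & \omega^8 & b & -b\\ -i & \omega^8 & \omega^4 & \omega^7 & \omega^5 & ai & -ai & \omega & \omega\\ -i & \omega^4 & \omega^8 & \omega^{11} & \omega & \omega^5 & \omega^5 & bi & -bi\\ -1 & 1 & -1 & 1 & -1 & a\omega^{11} & -a\omega^{11} & b\omega^7 & -b\omega^7\\ -1 & -i & -i & i & i & a\omega^7 & -a\omega^7 & b\omega^{11} & -b\omega^{11}\\ -1 & i & 1 & -1 & -i & -a & a & -b & b \end{bmatrix}$$ is a complex Hadamard matrix of order $10$; that is, $Y(p_1,p_2)$, $p_1,p_2\in[0,1)$, is a two-parameter affine family of complex Hadamard matrices of order $10$.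
   Context: A complex Hadamard matrix of order $N$ is a matrix $H\in\mathbb{C}^{N\times N}$ all of whose entries have modulus $1$ and which satisfies $HH^{\dagger}=N\mathbb{I}_N$. A family of such matrices is called affine if, writing the entries as $\exp\{2i\pi p_{jk}\}$, the phases $p_{jk}$ depend linearly (affinely) on the independent parameters. Here $i$ is the imaginary unit. *)

theory Defs
  imports
    "HOL-Analysis.Product_Vector"
    "Jordan_Normal_Form.Schur_Decomposition"
begin

definition complex_hadamard :: "nat \<Rightarrow> complex mat \<Rightarrow> bool" where
  "complex_hadamard N H \<longleftrightarrow>
     H \<in> carrier_mat N N \<and>
     (\<forall>j<N. \<forall>k<N. cmod (H $$ (j, k)) = 1) \<and>
     H * mat_adjoint H = of_nat N \<cdot>\<^sub>m 1\<^sub>m N"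

text \<open>
  The entries are \<open>exp (2 \<pi> \<i> p\<^sub>j\<^sub>k)\<close> with \<open>p\<^sub>j\<^sub>k = c j k + L j k p\<close> affine in the parameter
  vector \<open>p\<close>, which ranges over \<open>P\<close>; the dimension of the type \<open>'p\<close> is the number of parameters.
  The last conjunct says that the parameters are independent: no nonzero direction in parameter
  space leaves all phases fixed, so a family with fewer parameters does not qualify.
\<close>

definition affine_hadamard_family ::
    "nat \<Rightarrow> 'p::real_vector set \<Rightarrow> ('p \<Rightarrow> complex mat) \<Rightarrow> bool" where
  "affine_hadamard_family N P F \<longleftrightarrow>
     (\<forall>p\<in>P. complex_hadamard N (F p)) \<and>
     (\<exists>(c :: nat \<Rightarrow> nat \<Rightarrow> real) (L :: nat \<Rightarrow> nat \<Rightarrow> 'p \<Rightarrow> real).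
        (\<forall>j<N. \<forall>k<N. linear (L j k)) \<and>
        (\<forall>p\<in>P. \<forall>j<N. \<forall>k<N.
           F p $$ (j, k) = exp (2 * \<i> * of_real pi * of_real (c j k + L j k p))) \<and>
        (\<forall>v. (\<forall>j<N. \<forall>k<N. L j k v = 0) \<longrightarrow> v = 0))"

definition Y10_core :: "real \<Rightarrow> real \<Rightarrow> complex mat" where
  "Y10_core p1 p2 =
     (let \<omega> = exp (\<i> * of_real pi / 6);
          a = exp (2 * \<i> * of_real pi * of_real p1);
          b = exp (2 * \<i> * of_real pi * of_real p2)
      in mat_of_rows_list 9
       [[ 1, -\<i>,   \<i>,    \<i>,    -\<i>,   \<omega>^4,   \<omega>^4,    \<omega>^8,   \<omega>^8],
        [ 1,  \<i>,  -1,   -1,     \<i>,   \<omega>^11,  \<omega>^11,   \<omega>^7,   \<omega>^7],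
        [ \<i>,  \<omega>^8, \<omega>^10, \<omega>^7,  \<omega>^11, a,     -a,     \<omega>^4,   \<omega>^4],
        [ \<i>,  \<omega>^4, \<omega>^2,  \<omega>^11, \<omega>^7,  \<omega>^8,   \<omega>^8,    b,     -b],
        [-\<i>,  \<omega>^8, \<omega>^4,  \<omega>^7,  \<omega>^5,  a*\<i>,   -a*\<i>,    \<omega>,     \<omega>],
        [-\<i>,  \<omega>^4, \<omega>^8,  \<omega>^11, \<omega>,    \<omega>^5,   \<omega>^5,    b*\<i>,   -b*\<i>],
        [-1,  1,   -1,    1,    -1,    a*\<omega>^11, -a*\<omega>^11, b*\<omega>^7,  -b*\<omega>^7],
        [-1, -\<i>,  -\<i>,    \<i>,     \<i>,    a*\<omega>^7,  -a*\<omega>^7,  b*\<omega>^11, -b*\<omega>^11],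
        [-1,  \<i>,   1,   -1,    -\<i>,   -a,      a,     -b,      b]])"

definition Y10 :: "real \<Rightarrow> real \<Rightarrow> complex mat" where
  "Y10 p1 p2 =
     mat 10 10 (\<lambda>(j, k). if j = 0 \<or> k = 0 then 1 else Y10_core p1 p2 $$ (j - 1, k - 1))"

end

theory Submission
  imports Defs
begin

text \<open>
  Every entry of the matrix is a monomial \<open>\<omega>\<^sup>m a\<^sup>u b\<^sup>v\<close>, so its phase is affine in the parameters, and
  the product of an entry with the conjugate of another one is again a monomial. Reducing the
  powers of \<open>\<omega>\<close> by \<open>\<omega>\<^sup>4 = \<omega>\<^sup>2 - 1\<close> turns the inner product of two distinct rows into a
  linear combination of the \<open>\<omega>\<^sup>m a\<^sup>u b\<^sup>v\<close> with \<open>0 \<le> m < 4\<close>, all of whose coefficients cancel.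
\<close>

definition phase_exp :: "real \<Rightarrow> complex" where
  "phase_exp t = exp (2 * \<i> * of_real pi * of_real t)"

lemma phase_exp_0 [simp]: "phase_exp 0 = 1"
  by (simp add: phase_exp_def)

lemma phase_exp_add: "phase_exp (s + t) = phase_exp s * phase_exp t"
  by (simp add: phase_exp_def exp_add [symmetric] algebra_simps)

lemma phase_exp_power: "phase_exp t ^ n = phase_exp (of_nat n * t)"
  by (simp add: phase_exp_def exp_of_nat_mult [symmetric] algebra_simps)

lemma phase_exp_eq_cis: "phase_exp t = cis (2 * pi * t)"
  by (simp add: phase_exp_def cis_conv_exp algebra_simps)

lemma norm_phase_exp [simp]: "cmod (phase_exp t) = 1"
  by (simp add: phase_exp_eq_cis)

lemma cnj_phase_exp: "cnj (phase_exp t) = phase_exp (- t)"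
  by (simp add: phase_exp_eq_cis cis_cnj)

lemma phase_exp_half: "phase_exp (1 / 2) = - 1"
  by (simp add: phase_exp_def)

lemma phase_exp_quarter: "phase_exp (1 / 4) = \<i>"
  by (simp add: phase_exp_eq_cis)

text \<open>This is the relation \<open>\<omega>\<^sup>2 = \<omega>\<^sup>4 + 1\<close> for the
  primitive 12th root of unity \<omega>, whose phase is 1/12.\<close>

lemma phase_exp_sixth: "phase_exp (1 / 6) = phase_exp (1 / 3) + 1"
proof -
  \<comment> \<open>The second angle is kept as twice the first, so that the double-angle formulas
    reduce everything to 60 degrees.\<close>
  have "phase_exp (1 / 6) = cis (pi / 3)" "phase_exp (1 / 3) = cis (2 * (pi / 3))"
    by (simp_all add: phase_exp_eq_cis)
  then show ?thesis
    by (simp only: cis.sel complex_eq_iff cos_double_cos sin_double cos_60 sin_60)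
      (simp add: power2_eq_square cos_60 sin_60)
qed

lemma mult_mat_adjoint_index:
  fixes H :: "complex mat"
  assumes "H \<in> carrier_mat m n" "j < m" "l < m"
  shows "(H * mat_adjoint H) $$ (j, l) = (\<Sum>k<n. H $$ (j, k) * cnj (H $$ (l, k)))"
  using assms
  by (auto simp: mat_adjoint_def scalar_prod_def mat_of_rows_def lessThan_atLeast0
      intro!: sum.cong)

text \<open>The Gram matrix of the rows is Hermitian, so pairs with \<open>j < l\<close> suffice. On
  the diagonal all phase differences vanish and the sum is \<open>N\<close>.\<close>

lemma complex_hadamardI:
  assumes H: "H \<in> carrier_mat N N"
    and entry: "\<And>j k. j < N \<Longrightarrow> k < N \<Longrightarrow> H $$ (j, k) = phase_exp (\<theta> j k)"
    and orth: "\<And>j l. j < l \<Longrightarrow> l < N \<Longrightarrow> (\<Sum>k<N. phase_exp (\<theta> j k - \<theta> l k)) = 0"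
  shows "complex_hadamard N H"
proof -
  have gram: "(\<Sum>k<N. H $$ (j, k) * cnj (H $$ (l, k))) = (\<Sum>k<N. phase_exp (\<theta> j k - \<theta> l k))"
    if "j < N" "l < N" for j l
    using that by (simp add: entry cnj_phase_exp flip: phase_exp_add)
  have orth': "(\<Sum>k<N. phase_exp (\<theta> j k - \<theta> l k)) = 0" if "l < j" "j < N" for j l
  proof -
    have "(\<Sum>k<N. phase_exp (\<theta> j k - \<theta> l k)) = cnj (\<Sum>k<N. phase_exp (\<theta> l k - \<theta> j k))"
      by (simp add: cnj_phase_exp)
    with orth [OF that] show ?thesis by simp
  qed
  have "H * mat_adjoint H = of_nat N \<cdot>\<^sub>m 1\<^sub>m N"
  proof (rule eq_matI)
    fix j l assume "j < dim_row (of_nat N \<cdot>\<^sub>m 1\<^sub>m N :: complex mat)"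
      and "l < dim_col (of_nat N \<cdot>\<^sub>m 1\<^sub>m N :: complex mat)"
    then have jl: "j < N" "l < N" by auto
    have "(\<Sum>k<N. phase_exp (\<theta> j k - \<theta> l k)) = (if j = l then of_nat N else 0)"
      using orth orth' jl by (cases j l rule: linorder_cases) auto
    with jl show "(H * mat_adjoint H) $$ (j, l) = (of_nat N \<cdot>\<^sub>m 1\<^sub>m N) $$ (j, l)"
      by (simp add: mult_mat_adjoint_index [OF H] gram)
  qed (use H in \<open>auto simp: mat_adjoint_def\<close>)
  with H show ?thesis
    by (simp add: complex_hadamard_def entry)
qed

text \<open>
  An entry \<open>(m, u, v)\<close> encodes \<open>\<omega>\<^sup>m a\<^sup>u b\<^sup>v\<close>, where \<open>\<i> = \<omega>\<^sup>3\<close> and \<open>- 1 = \<omega>\<^sup>6\<close>.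
\<close>

definition Y10_table :: "(int \<times> int \<times> int) list list" where
  "Y10_table =
    [[(0,0,0), (0,0,0), (0,0,0), (0,0,0), (0,0,0), (0,0,0), (0,0,0), (0,0,0), (0,0,0), (0,0,0)],
     [(0,0,0), (0,0,0), (9,0,0), (3,0,0), (3,0,0), (9,0,0), (4,0,0), (4,0,0), (8,0,0), (8,0,0)],
     [(0,0,0), (0,0,0), (3,0,0), (6,0,0), (6,0,0), (3,0,0), (11,0,0), (11,0,0), (7,0,0), (7,0,0)],
     [(0,0,0), (3,0,0), (8,0,0), (10,0,0), (7,0,0), (11,0,0), (0,1,0), (6,1,0), (4,0,0), (4,0,0)],
     [(0,0,0), (3,0,0), (4,0,0), (2,0,0), (11,0,0), (7,0,0), (8,0,0), (8,0,0), (0,0,1), (6,0,1)],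
     [(0,0,0), (9,0,0), (8,0,0), (4,0,0), (7,0,0), (5,0,0), (3,1,0), (9,1,0), (1,0,0), (1,0,0)],
     [(0,0,0), (9,0,0), (4,0,0), (8,0,0), (11,0,0), (1,0,0), (5,0,0), (5,0,0), (3,0,1), (9,0,1)],
     [(0,0,0), (6,0,0), (0,0,0), (6,0,0), (0,0,0), (6,0,0), (11,1,0), (5,1,0), (7,0,1), (1,0,1)],
     [(0,0,0), (6,0,0), (9,0,0), (9,0,0), (3,0,0), (3,0,0), (7,1,0), (1,1,0), (11,0,1), (5,0,1)],
     [(0,0,0), (6,0,0), (3,0,0), (0,0,0), (6,0,0), (9,0,0), (6,1,0), (0,1,0), (6,0,1), (0,0,1)]]"

fun table_phase :: "int \<times> int \<times> int \<Rightarrow> real \<times> real \<Rightarrow> real" where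
  "table_phase (m, u, v) (p1, p2) = of_int m / 12 + (of_int u * p1 + of_int v * p2)"

text \<open>Integer exponents allow the negative differences that conjugation produces. With this
  definition kept folded, the monomials serve as atoms of linear arithmetic.\<close>

definition monomial :: "real \<times> real \<Rightarrow> int \<Rightarrow> int \<Rightarrow> int \<Rightarrow> complex" where
  "monomial p m u v = phase_exp (table_phase (m, u, v) p)"

lemma monomial_add_6: "monomial p (m + 6) u v = - monomial p m u v"
proof (cases p)
  case (Pair p1 p2)
  then show ?thesis
    using phase_exp_add [of "table_phase (m, u, v) p" "1 / 2"]
    by (simp add: monomial_def phase_exp_half add_divide_distrib algebra_simps)
qed

lemma monomial_add_4: "monomial p (m + 4) u v = monomial p (m + 2) u v - monomial p m u v"
proof (cases p)
  case (Pair p1 p2)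
  then show ?thesis
    \<comment> \<open>The shifts 1/6 and 1/3 are the phases of \<open>\<omega>\<^sup>2\<close> and
      \<open>\<omega>\<^sup>4\<close>.\<close>
    using phase_exp_add [of "table_phase (m, u, v) p" "1 / 6"]
      phase_exp_add [of "table_phase (m, u, v) p" "1 / 3"] phase_exp_sixth
    by (simp add: monomial_def add_divide_distrib algebra_simps)
qed

text \<open>Exponents of \<omega> in the table lie between 0 and 11, so their differences lie
  between -11 and 11. These rules and \<open>monomial_reduce_neg\<close> bring each of them to the
  basis exponents 0 to 3.\<close>

lemma monomial_reduce_nonneg:
  "monomial p 4 u v = monomial p 2 u v - monomial p 0 u v"
  "monomial p 5 u v = monomial p 3 u v - monomial p 1 u v"
  "monomial p 6 u v = - monomial p 0 u v"
  "monomial p 7 u v = - monomial p 1 u v"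
  "monomial p 8 u v = - monomial p 2 u v"
  "monomial p 9 u v = - monomial p 3 u v"
  "monomial p 10 u v = monomial p 0 u v - monomial p 2 u v"
  "monomial p 11 u v = monomial p 1 u v - monomial p 3 u v"
  using monomial_add_4 [of p 0 u v] monomial_add_4 [of p 1 u v]
    monomial_add_6 [of p 0 u v] monomial_add_6 [of p 1 u v] monomial_add_6 [of p 2 u v]
    monomial_add_6 [of p 3 u v] monomial_add_6 [of p 4 u v] monomial_add_6 [of p 5 u v]
  by simp_all

lemma monomial_reduce_neg:
  "monomial p (- 1) u v = monomial p 1 u v - monomial p 3 u v"
  "monomial p (- 2) u v = monomial p 0 u v - monomial p 2 u v"
  "monomial p (- 3) u v = - monomial p 3 u v"
  "monomial p (- 4) u v = - monomial p 2 u v"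
  "monomial p (- 5) u v = - monomial p 1 u v"
  "monomial p (- 6) u v = - monomial p 0 u v"
  "monomial p (- 7) u v = monomial p 3 u v - monomial p 1 u v"
  "monomial p (- 8) u v = monomial p 2 u v - monomial p 0 u v"
  "monomial p (- 9) u v = monomial p 3 u v"
  "monomial p (- 10) u v = monomial p 2 u v"
  "monomial p (- 11) u v = monomial p 1 u v"
proof -
  have diff_12: "monomial p (m - 12) u v = monomial p m u v" for m
    using monomial_add_6 [of p "m - 12" u v] monomial_add_6 [of p "m - 6" u v] by simp
  show
    "monomial p (- 1) u v = monomial p 1 u v - monomial p 3 u v"
    "monomial p (- 2) u v = monomial p 0 u v - monomial p 2 u v"
    "monomial p (- 3) u v = - monomial p 3 u v"
    "monomial p (- 4) u v = - monomial p 2 u v"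
    "monomial p (- 5) u v = - monomial p 1 u v"
    "monomial p (- 6) u v = - monomial p 0 u v"
    "monomial p (- 7) u v = monomial p 3 u v - monomial p 1 u v"
    "monomial p (- 8) u v = monomial p 2 u v - monomial p 0 u v"
    "monomial p (- 9) u v = monomial p 3 u v"
    "monomial p (- 10) u v = monomial p 2 u v"
    "monomial p (- 11) u v = monomial p 1 u v"
    using diff_12 [of 1] diff_12 [of 2] diff_12 [of 3] diff_12 [of 4] diff_12 [of 5]
      diff_12 [of 6] diff_12 [of 7] diff_12 [of 8] diff_12 [of 9] diff_12 [of 10] diff_12 [of 11]
    by (simp_all add: monomial_reduce_nonneg)
qed

text \<open>\<open>sorted_wrt\<close> relates each row to every later one, so simplification unfolds
  it into 45 identities. Each cancels formally, for arbitrary real parameters.\<close>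

lemma Y10_table_orthogonal:
  "sorted_wrt
     (\<lambda>r s. (\<Sum>((m, u, v), (m', u', v'))\<leftarrow>zip r s. monomial p (m - m') (u - u') (v - v')) = 0)
     Y10_table"
  by (simp add: Y10_table_def monomial_reduce_nonneg monomial_reduce_neg)

lemma length_Y10_table: "length Y10_table = 10"
  by (simp add: Y10_table_def)

lemma length_Y10_table_row: "j < 10 \<Longrightarrow> length (Y10_table ! j) = 10"
  by (auto simp: Y10_table_def less_Suc_eq numeral_eq_Suc)

lemma phase_exp_table_diff:
  "phase_exp (table_phase t p - table_phase t' p) =
    (case (t, t') of ((m, u, v), (m', u', v')) \<Rightarrow> monomial p (m - m') (u - u') (v - v'))"
  by (cases t; cases t'; cases p) (simp add: monomial_def algebra_simps diff_divide_distrib)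

lemma Y10_phase_orthogonal:
  assumes "j < l" "l < 10"
  shows "(\<Sum>k<10. phase_exp (table_phase (Y10_table ! j ! k) p - table_phase (Y10_table ! l ! k) p)) = 0"
proof -
  have "(\<Sum>((m, u, v), (m', u', v'))\<leftarrow>zip (Y10_table ! j) (Y10_table ! l).
      monomial p (m - m') (u - u') (v - v')) = 0"
    using sorted_wrt_nth_less [OF Y10_table_orthogonal assms(1)] assms(2)
    by (simp add: length_Y10_table)
  with assms show ?thesis
    by (simp add: phase_exp_table_diff sum_list_sum_nth length_Y10_table_row lessThan_atLeast0
        case_prod_unfold)
qed

lemma Y10_index:
  assumes "j < 10" "k < 10"
  shows "Y10 p1 p2 $$ (j, k) = phase_exp (table_phase (Y10_table ! j ! k) (p1, p2))"
proof -
  have omega: "exp (\<i> * of_real pi / 6) = phase_exp (1 / 12)"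
    and i: "\<i> = phase_exp (1 / 4)"
    and minus_1: "- 1 = phase_exp (1 / 2)"
    by (simp_all only: phase_exp_quarter phase_exp_half) (simp add: phase_exp_def)
  have minus: "- phase_exp t = phase_exp (t + 1 / 2)" for t
    by (simp add: phase_exp_add phase_exp_half)
  have period: "phase_exp (t + 1) = phase_exp t" for t
    by (simp add: phase_exp_add phase_exp_eq_cis [of 1])
  \<comment> \<open>The minus signs in \<open>-a*\<omega>^7\<close> and
    \<open>-a*\<omega>^11\<close>, and likewise for \<open>b\<close>, add 1/2 to the phases 7/12 and
    11/12. The table stores the results modulo 1.\<close>
  have wrap: "phase_exp (t + 13 / 12) = phase_exp (t + 1 / 12)"
    "phase_exp (t + 17 / 12) = phase_exp (t + 5 / 12)" for t
    using period [of "t + 1 / 12"] period [of "t + 5 / 12"] by (simp_all add: add.assoc)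
  have "\<forall>j\<in>{..<10}. \<forall>k\<in>{..<10}.
      Y10 p1 p2 $$ (j, k) = phase_exp (table_phase (Y10_table ! j ! k) (p1, p2))"
    by (simp add: Y10_def Y10_core_def Y10_table_def mat_of_rows_list_def Let_def
        omega phase_exp_def [symmetric] lessThan_nat_numeral lessThan_Suc)
      \<comment> \<open>The given exponentials are already folded into \<open>phase_exp\<close>, so
        rewriting \<i> as a phase can no longer destroy their form.\<close>
      (simp add: i minus_1 minus phase_exp_power wrap phase_exp_add [symmetric] algebra_simps)
  then show ?thesis
    using assms by auto
qed

lemma carrier_Y10 [simp]: "Y10 p1 p2 \<in> carrier_mat 10 10"
  by (simp add: Y10_def)

lemma complex_hadamard_Y10: "complex_hadamard 10 (Y10 p1 p2)"
  by (rule complex_hadamardI [where \<theta> = "\<lambda>j k. table_phase (Y10_table ! j ! k) (p1, p2)"])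
    (simp_all add: Y10_index Y10_phase_orthogonal)

theorem mainTheorem3:
  shows "(\<forall>p1\<in>{0..<1}. \<forall>p2\<in>{0..<1}. complex_hadamard 10 (Y10 p1 p2)) \<and>
    affine_hadamard_family 10 ({0..<1} \<times> {0..<1}) (\<lambda>(p1 :: real, p2 :: real). Y10 p1 p2)"
proof -
  define c :: "nat \<Rightarrow> nat \<Rightarrow> real" where
    "c j k = (case Y10_table ! j ! k of (m, u, v) \<Rightarrow> of_int m / 12)" for j k
  define L :: "nat \<Rightarrow> nat \<Rightarrow> real \<times> real \<Rightarrow> real" where
    "L j k p = (case Y10_table ! j ! k of (m, u, v) \<Rightarrow> of_int u * fst p + of_int v * snd p)"
    for j k p
  have phase: "table_phase (Y10_table ! j ! k) p = c j k + L j k p" for j k p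
    by (cases p) (simp add: c_def L_def split: prod.split)
  have linear: "linear (L j k)" for j k
    unfolding L_def by (rule linearI) (auto simp: algebra_simps split: prod.split)
  have independent: "v = 0" if "\<forall>j<10. \<forall>k<10. L j k v = 0" for v
  proof -
    \<comment> \<open>At these two positions the entries are exactly \<open>a\<close> and
      \<open>b\<close>, so the linear parts are the two coordinates of \<open>v\<close>.\<close>
    have "L 3 6 v = 0" "L 4 8 v = 0"
      using that by simp_all
    then show ?thesis
      by (simp add: L_def Y10_table_def prod_eq_iff)
  qed
  show ?thesis
    unfolding affine_hadamard_family_def
    using complex_hadamard_Y10 linear independent
    by (intro conjI exI [of _ c] exI [of _ L])
      (auto simp: Y10_index phase phase_exp_def)
qed

end
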